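(* If $X$ is an ambitable semiuniform semigroup then $\mathbf{M_u}(X)=\Lambda(\mathbf{M}(X))$ and $\widehat{X}=\Lambda(\overline{X})$.
   Context: All uniform spaces are Hausdorff, all linear spaces are over $\mathbb{R}$. A semigroup $X$ with a uniform structure is a semiuniform semigroup if (a) the set of maps $\{x\mapsto xy : y\in X\}$ from $X$ to $X$ is uniformly equicontinuous, and (b) for each $x\in X$ the map $y\mapsto xy$ from $X$ to $X$ is uniformly continuous. $\mathbf{U_b}(X)$ is the space of bounded uniformly continuous real-valued functions on $X$ with the sup norm; $\mathbf{M}(X)$ is its norm dual; the weak* topology on $\mathbf{M}(X)$ is the weak topology of the duality $\langle\mathbf{M}(X),\mathbf{U_b}(X)\rangle$. For a uniformly continuous pseudometric $\Delta$ on $X$, $\mathrm{Lip}(\Delta)$ is the set of $f:X\to[-1,1]$ with $|f(x)-f(x')|\le\Delta(x,x')$ for all $x,x'$, and $\mathrm{Lip}^+(\Delta)=\{f\in\mathrm{Lip}(\Delta): f\ge0\}$, both with the topology of pointwise convergence on $X$. $\mathbf{M_u}(X)$ is the set of $\mu\in\mathbf{M}(X)$ that are continuous on $\mathrm{Lip}(\Delta)$ for every uniformly continuous pseudometric $\Delta$ on $X$ (equivalently, continuous on $\mathrm{Lip}^+(\Delta)$ for every such $\Delta$). For $x\in X$, $\delta_x\in\mathbf{M}(X)$ is $\delta_x(f)=f(x)$; $\overline{X}$ is the weak* closure of $\{\delta_x:x\in X\}$ in $\mathbf{M}(X)$, and $\widehat{X}=\overline{X}\cap\mathbf{M_u}(X)$.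 Convolution on $\mathbf{M}(X)$: $(\mu\star\nu)(f)=\mu\big(x\mapsto\nu(y\mapsto f(xy))\big)$ for $f\in\mathbf{U_b}(X)$. With $\star$, $\mathbf{M}(X)$ is a semigroup and $\overline{X}$ is a subsemigroup; both are considered with the weak* topology. For $f:X\to\mathbb{R}$ and $x\in X$, the right translation is $\rho^x(f): z\mapsto f(zx)$; $\mathrm{orb}(f)=\{\rho^x(f):x\in X\}$; $\overline{\mathrm{orb}(f)}$ is its closure in the product space $\mathbb{R}^X$. A semiuniform semigroup $X$ is ambitable if for every uniformly continuous pseudometric $\Delta$ on $X$ there exists $f\in\mathbf{U_b}(X)$ such that $\mathrm{Lip}^+(\Delta)\subseteq\overline{\mathrm{orb}(f)}$. For a semigroup $S$ with a topology, $\Lambda(S)=\{x\in S : \text{the map } y\mapsto xy \text{ is continuous on } S\}$. *)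

theory Defs
  imports "HOL-Analysis.Analysis"
begin

section \<open>Bounded uniformly continuous functions and their dual\<close>

definition Ub :: "('a::uniform_space \<Rightarrow> real) set"
  where "Ub = {f. bounded (range f) \<and> uniformly_continuous_on UNIV f}"

lemma uniformly_continuous_real_iff:
  fixes f :: "'a::uniform_space \<Rightarrow> real"
  shows "uniformly_continuous_on UNIV f \<longleftrightarrow>
    (\<forall>e>0. eventually (\<lambda>(x, y). \<bar>f x - f y\<bar> < e) uniformity)"
proof
  assume L: "uniformly_continuous_on UNIV f"
  show "\<forall>e>0. eventually (\<lambda>(x, y). \<bar>f x - f y\<bar> < e) uniformity"
  proof (intro allI impI)
    fix e :: real assume "e > 0"
    then have "eventually (\<lambda>(u, v). dist u v < e) (uniformity :: (real \<times> real) filter)"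
      by (auto simp: eventually_uniformity_metric)
    from uniformly_continuous_onD[OF L this]
    show "eventually (\<lambda>(x, y). \<bar>f x - f y\<bar> < e) uniformity"
      by (simp add: dist_real_def)
  qed
next
  assume R: "\<forall>e>0. eventually (\<lambda>(x, y). \<bar>f x - f y\<bar> < e) uniformity"
  show "uniformly_continuous_on UNIV f"
    unfolding uniformly_continuous_on_uniformity filterlim_iff
  proof (intro allI impI)
    fix P :: "real \<times> real \<Rightarrow> bool" assume "eventually P uniformity"
    then obtain e where e: "e > 0" "\<And>u v. dist u v < e \<Longrightarrow> P (u, v)"
      by (auto simp: eventually_uniformity_metric)
    from R e(1) have "eventually (\<lambda>(x, y). \<bar>f x - f y\<bar> < e) uniformity" by blast
    then show "\<forall>\<^sub>F x in uniformity_on UNIV. P (case x of (x, y) \<Rightarrow> (f x, f y))"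
      by (auto simp: e(2) dist_real_def case_prod_unfold elim!: eventually_mono)
  qed
qed

lemma Ub_const: "(\<lambda>_. c) \<in> Ub"
  by (auto simp: Ub_def uniformly_continuous_real_iff case_prod_unfold)

lemma Ub_add: "f \<in> Ub \<Longrightarrow> g \<in> Ub \<Longrightarrow> (\<lambda>x. f x + g x) \<in> Ub"
  unfolding Ub_def mem_Collect_eq
proof (intro conjI)
  assume *: "bounded (range f) \<and> uniformly_continuous_on UNIV f"
    "bounded (range g) \<and> uniformly_continuous_on UNIV g"
  then show "bounded (range (\<lambda>x. f x + g x))" by (auto intro: bounded_plus_comp)
  show "uniformly_continuous_on UNIV (\<lambda>x. f x + g x)"
    unfolding uniformly_continuous_real_iff
  proof (intro allI impI)
    fix e :: real assume "e > 0"
    then have "e / 2 > 0" by simp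
    with * have "eventually (\<lambda>(x, y). \<bar>f x - f y\<bar> < e / 2) uniformity"
      "eventually (\<lambda>(x, y). \<bar>g x - g y\<bar> < e / 2) uniformity"
      unfolding uniformly_continuous_real_iff by blast+
    then show "eventually (\<lambda>(x, y). \<bar>f x + g x - (f y + g y)\<bar> < e) uniformity"
    proof (eventually_elim, clarify)
      fix x y
      assume "\<bar>f x - f y\<bar> < e / 2" "\<bar>g x - g y\<bar> < e / 2"
      then show "\<bar>f x + g x - (f y + g y)\<bar> < e" by arith
    qed
  qed
qed

lemma Ub_scale: "f \<in> Ub \<Longrightarrow> (\<lambda>x. c * f x) \<in> Ub"
  unfolding Ub_def mem_Collect_eq
proof (intro conjI)
  assume *: "bounded (range f) \<and> uniformly_continuous_on UNIV f"
  then show "bounded (range (\<lambda>x. c * f x))"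
    using bounded_scaleR_comp[of f UNIV c] by simp
  show "uniformly_continuous_on UNIV (\<lambda>x. c * f x)"
    unfolding uniformly_continuous_real_iff
  proof (intro allI impI)
    fix e :: real assume e: "e > 0"
    then have "e / (\<bar>c\<bar> + 1) > 0" by simp
    with * have "eventually (\<lambda>(x, y). \<bar>f x - f y\<bar> < e / (\<bar>c\<bar> + 1)) uniformity"
      unfolding uniformly_continuous_real_iff by blast
    moreover have "\<bar>c * u - c * v\<bar> < e" if "\<bar>u - v\<bar> < e / (\<bar>c\<bar> + 1)" for u v :: real
    proof -
      have "\<bar>c * u - c * v\<bar> = \<bar>c\<bar> * \<bar>u - v\<bar>"
        by (simp add: abs_mult[symmetric] right_diff_distrib)
      also have "\<dots> \<le> (\<bar>c\<bar> + 1) * \<bar>u - v\<bar>" by (simp add: mult_right_mono)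
      also have "\<dots> < e" using that by (simp add: field_simps)
      finally show ?thesis .
    qed
    ultimately show "eventually (\<lambda>(x, y). \<bar>c * f x - c * f y\<bar> < e) uniformity"
      by (auto elim!: eventually_mono)
  qed
qed

text \<open>The space \<open>U\<^sub>b(X)\<close>, where \<open>X\<close> is the universe of the type \<open>'a\<close>.\<close>

typedef (overloaded) 'a ubfun = "Ub :: ('a::uniform_space \<Rightarrow> real) set"
  morphisms apply_ubfun Abs_ubfun
  using Ub_const by blast

declare [[coercion apply_ubfun]]

setup_lifting type_definition_ubfun

instantiation ubfun :: (uniform_space) real_normed_vector
begin

lift_definition zero_ubfun :: "'a ubfun" is "\<lambda>_. 0"
  by (rule Ub_const)

lift_definition plus_ubfun :: "'a ubfun \<Rightarrow> 'a ubfun \<Rightarrow> 'a ubfun" is "\<lambda>f g x. f x + g x"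
  by (rule Ub_add)

lift_definition uminus_ubfun :: "'a ubfun \<Rightarrow> 'a ubfun" is "\<lambda>f x. - f x"
  using Ub_scale[of _ "-1"] by simp

lift_definition minus_ubfun :: "'a ubfun \<Rightarrow> 'a ubfun \<Rightarrow> 'a ubfun" is "\<lambda>f g x. f x - g x"
  using Ub_add Ub_scale[of _ "-1"] by fastforce

lift_definition scaleR_ubfun :: "real \<Rightarrow> 'a ubfun \<Rightarrow> 'a ubfun" is "\<lambda>r f x. r * f x"
  by (rule Ub_scale)

lift_definition norm_ubfun :: "'a ubfun \<Rightarrow> real" is "\<lambda>f. SUP x. \<bar>f x\<bar>" .

definition dist_ubfun :: "'a ubfun \<Rightarrow> 'a ubfun \<Rightarrow> real"
  where "dist_ubfun f g = norm (f - g)"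

definition sgn_ubfun :: "'a ubfun \<Rightarrow> 'a ubfun"
  where "sgn_ubfun f = inverse (norm f) *\<^sub>R f"

definition uniformity_ubfun :: "('a ubfun \<times> 'a ubfun) filter"
  where "uniformity_ubfun = (INF e\<in>{0 <..}. principal {(x, y). dist x y < e})"

definition open_ubfun :: "'a ubfun set \<Rightarrow> bool"
  where "open_ubfun S = (\<forall>x\<in>S. \<forall>\<^sub>F (x', y) in uniformity. x' = x \<longrightarrow> y \<in> S)"

lemma abs_apply_ubfun_le: "\<bar>apply_ubfun f x\<bar> \<le> norm f"
proof transfer
  fix f :: "'a \<Rightarrow> real" and x assume "f \<in> Ub"
  then have "bdd_above (range (\<lambda>x. \<bar>f x\<bar>))"
    by (auto simp: Ub_def bounded_iff bdd_above_def)
  then show "\<bar>f x\<bar> \<le> (SUP x. \<bar>f x\<bar>)" by (rule cSUP_upper[OF UNIV_I])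
qed

lemma norm_ubfun_le: "(\<And>x. \<bar>apply_ubfun f x\<bar> \<le> b) \<Longrightarrow> norm f \<le> b"
  by transfer (auto intro: cSUP_least)

instance
proof
  fix f g h :: "'a ubfun" and a b :: real
  show "f + g + h = f + (g + h)" "f + g = g + f" "0 + f = f" "- f + f = 0" "f - g = f + - g"
    "a *\<^sub>R (f + g) = a *\<^sub>R f + a *\<^sub>R g" "(a + b) *\<^sub>R f = a *\<^sub>R f + b *\<^sub>R f"
    "a *\<^sub>R b *\<^sub>R f = (a * b) *\<^sub>R f" "1 *\<^sub>R f = f"
    by (transfer; simp add: algebra_simps)+
  show "dist f g = norm (f - g)" by (rule dist_ubfun_def)
  show "sgn f = inverse (norm f) *\<^sub>R f" by (rule sgn_ubfun_def)
  show "uniformity = (INF e\<in>{0<..}. principal {(x::'a ubfun, y). dist x y < e})"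
    by (rule uniformity_ubfun_def)
  show "open U = (\<forall>x\<in>U. \<forall>\<^sub>F (x', y) in uniformity. x' = x \<longrightarrow> y \<in> U)" for U :: "'a ubfun set"
    by (rule open_ubfun_def)
  show "norm f = 0 \<longleftrightarrow> f = 0"
  proof
    assume "norm f = 0"
    then have "apply_ubfun f x = 0" for x using abs_apply_ubfun_le[of f x] by simp
    then show "f = 0" by transfer auto
  next
    assume "f = 0"
    then show "norm f = 0" by (simp only:) (transfer, simp)
  qed
  show "norm (f + g) \<le> norm f + norm g"
  proof (rule norm_ubfun_le)
    fix x
    show "\<bar>apply_ubfun (f + g) x\<bar> \<le> norm f + norm g"
      using abs_apply_ubfun_le[of f x] abs_apply_ubfun_le[of g x]
      by (simp add: plus_ubfun.rep_eq)
  qed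
  have scale_le: "norm (r *\<^sub>R k) \<le> \<bar>r\<bar> * norm k" for r and k :: "'a ubfun"
    by (rule norm_ubfun_le)
      (simp add: scaleR_ubfun.rep_eq abs_mult mult_left_mono abs_apply_ubfun_le)
  show "norm (a *\<^sub>R f) = \<bar>a\<bar> * norm f"
  proof (cases "a = 0")
    case True
    have "norm (0 *\<^sub>R f) = 0" by transfer simp
    with True show ?thesis by simp
  next
    case False
    have "inverse a *\<^sub>R a *\<^sub>R f = f" using False by transfer (simp add: mult.assoc[symmetric])
    then have "norm f \<le> \<bar>inverse a\<bar> * norm (a *\<^sub>R f)" using scale_le[of "inverse a" "a *\<^sub>R f"] by simp
    then have "\<bar>a\<bar> * norm f \<le> norm (a *\<^sub>R f)" using False by (simp add: field_simps)
    with scale_le[of a f] show ?thesis by simp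
  qed
qed

end

text \<open>
  The norm dual \<open>M(X)\<close> is the type \<open>'a ubfun \<Rightarrow>\<^sub>L real\<close> of bounded linear functionals. For scalar-valued
  operators the strong operator topology is the topology of pointwise convergence on \<open>U\<^sub>b(X)\<close>,
  i.e. the weak* topology.
\<close>

abbreviation weak_star :: "('a::uniform_space ubfun \<Rightarrow>\<^sub>L real) topology"
  where "weak_star \<equiv> strong_operator_topology"

definition point_eval :: "'a::uniform_space \<Rightarrow> 'a ubfun \<Rightarrow>\<^sub>L real"
  where "point_eval x = Blinfun (\<lambda>f. apply_ubfun f x)"

lemma point_eval_apply: "blinfun_apply (point_eval x) f = apply_ubfun f x"
  unfolding point_eval_def
  by (subst bounded_linear_Blinfun_apply)
    (auto intro!: bounded_linear_intro[of _ 1]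
      simp: plus_ubfun.rep_eq scaleR_ubfun.rep_eq abs_apply_ubfun_le)

definition Xbar :: "('a::uniform_space ubfun \<Rightarrow>\<^sub>L real) set"
  where "Xbar = weak_star closure_of (range point_eval)"


section \<open>Uniform measures\<close>

definition uc_pseudometric :: "('a::uniform_space \<Rightarrow> 'a \<Rightarrow> real) \<Rightarrow> bool"
  where "uc_pseudometric \<Delta> \<longleftrightarrow>
    (\<forall>x y. 0 \<le> \<Delta> x y) \<and> (\<forall>x. \<Delta> x x = 0) \<and> (\<forall>x y. \<Delta> x y = \<Delta> y x) \<and>
    (\<forall>x y z. \<Delta> x z \<le> \<Delta> x y + \<Delta> y z) \<and>
    uniformly_continuous_on UNIV (\<lambda>(x, y). \<Delta> x y)"

definition Lip :: "('a \<Rightarrow> 'a \<Rightarrow> real) \<Rightarrow> ('a \<Rightarrow> real) set"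
  where "Lip \<Delta> = {f. (\<forall>x. f x \<in> {-1..1}) \<and> (\<forall>x x'. \<bar>f x - f x'\<bar> \<le> \<Delta> x x')}"

definition Lip_plus :: "('a \<Rightarrow> 'a \<Rightarrow> real) \<Rightarrow> ('a \<Rightarrow> real) set"
  where "Lip_plus \<Delta> = {f \<in> Lip \<Delta>. \<forall>x. 0 \<le> f x}"

lemma Lip_subset_Ub:
  fixes \<Delta> :: "'a::uniform_space \<Rightarrow> 'a \<Rightarrow> real"
  assumes "uc_pseudometric \<Delta>"
  shows "Lip \<Delta> \<subseteq> Ub"
proof
  fix f assume f: "f \<in> Lip \<Delta>"
  have "bounded (range f)"
    using f by (auto simp: Lip_def bounded_iff abs_le_iff intro!: exI[of _ 1])
  moreover have "uniformly_continuous_on UNIV f"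
    unfolding uniformly_continuous_real_iff
  proof (intro allI impI)
    fix e :: real assume e: "e > 0"
    have "eventually (\<lambda>(p, q). \<bar>(case p of (x, y) \<Rightarrow> \<Delta> x y) - (case q of (x, y) \<Rightarrow> \<Delta> x y)\<bar> < e) uniformity"
      using assms e unfolding uc_pseudometric_def uniformly_continuous_real_iff by blast
    then obtain A B where AB: "eventually A uniformity" "eventually B uniformity"
      "\<And>u v. A u \<Longrightarrow> B v \<Longrightarrow> \<bar>\<Delta> (fst u) (fst v) - \<Delta> (snd u) (snd v)\<bar> < e"
      by (auto simp: uniformity_prod_def eventually_filtermap case_prod_unfold
          eventually_prod_filter)
    from AB(1) show "eventually (\<lambda>(x, y). \<bar>f x - f y\<bar> < e) uniformity"
    proof (rule eventually_mono, clarify)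
      fix x y assume "A (x, y)"
      then have "\<bar>\<Delta> x y - \<Delta> y y\<bar> < e"
        using AB(3)[of "(x, y)" "(y, y)"] uniformity_refl[OF AB(2)] by auto
      moreover have "\<Delta> y y = 0" using assms by (auto simp: uc_pseudometric_def)
      moreover have "\<bar>f x - f y\<bar> \<le> \<Delta> x y" using f by (auto simp: Lip_def)
      ultimately show "\<bar>f x - f y\<bar> < e" by simp
    qed
  qed
  ultimately show "f \<in> Ub" by (simp add: Ub_def)
qed

text \<open>
  The topology of functions \<open>'a \<Rightarrow> real\<close> is that of pointwise convergence. The use of
  \<open>Abs_ubfun\<close> is justified by \<open>Lip_subset_Ub\<close>.
\<close>

definition Mu :: "('a::uniform_space ubfun \<Rightarrow>\<^sub>L real) set"
  where "Mu = {\<mu>. \<forall>\<Delta>. uc_pseudometric \<Delta> \<longrightarrow>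
    continuous_on (Lip \<Delta>) (\<lambda>f. blinfun_apply \<mu> (Abs_ubfun f))}"

definition Xhat :: "('a::uniform_space ubfun \<Rightarrow>\<^sub>L real) set"
  where "Xhat = Xbar \<inter> Mu"


section \<open>Semiuniform semigroups, convolution, ambitability\<close>

class semiuniform_semigroup = semigroup_mult + uniform_space + t2_space +
  assumes right_mult_equicontinuous:
      "eventually E uniformity \<Longrightarrow>
        eventually (\<lambda>(x, x'). \<forall>y. E (x * y, x' * y)) uniformity"
    and left_mult_filterlim: "filterlim (\<lambda>(y, y'). (x * y, x * y')) uniformity uniformity"

lemma left_mult_uniformly_continuous:
  fixes x :: "'a::semiuniform_semigroup"
  shows "uniformly_continuous_on UNIV (\<lambda>y. x * y)"
  using left_mult_filterlim[of x] by (simp add: uniformly_continuous_on_uniformity)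

lemma left_translate_Ub:
  fixes x :: "'a::semiuniform_semigroup"
  assumes "f \<in> Ub"
  shows "(\<lambda>y. f (x * y)) \<in> Ub"
proof -
  have "bounded (range (\<lambda>y. f (x * y)))"
    using assms by (auto simp: Ub_def intro: bounded_subset)
  moreover have "uniformly_continuous_on UNIV f" using assms by (simp add: Ub_def)
  then have "uniformly_continuous_on UNIV (\<lambda>y. f (x * y))"
    unfolding uniformly_continuous_real_iff
    using uniformly_continuous_onD[OF left_mult_uniformly_continuous[of x]]
    by (fastforce simp: case_prod_unfold)
  ultimately show ?thesis by (simp add: Ub_def)
qed

lemma abs_blinfun_diff_le:
  fixes \<nu> :: "'a::uniform_space ubfun \<Rightarrow>\<^sub>L real"
  assumes "f \<in> Ub" "g \<in> Ub" "\<And>x. \<bar>f x - g x\<bar> \<le> b"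
  shows "\<bar>\<nu> (Abs_ubfun f) - \<nu> (Abs_ubfun g)\<bar> \<le> norm \<nu> * b"
proof -
  have "\<bar>\<nu> (Abs_ubfun f) - \<nu> (Abs_ubfun g)\<bar> \<le> norm \<nu> * norm (Abs_ubfun f - Abs_ubfun g)"
    using norm_blinfun[of \<nu> "Abs_ubfun f - Abs_ubfun g"] by (simp add: blinfun.diff_right)
  also have "norm (Abs_ubfun f - Abs_ubfun g) \<le> b"
    using assms by (intro norm_ubfun_le) (simp add: minus_ubfun.rep_eq Abs_ubfun_inverse)
  finally show ?thesis by (simp add: mult_left_mono)
qed

lemma convolve_Ub:
  fixes f :: "'a::semiuniform_semigroup \<Rightarrow> real" and \<nu> :: "'a ubfun \<Rightarrow>\<^sub>L real"
  assumes f: "f \<in> Ub"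
  shows "(\<lambda>x. \<nu> (Abs_ubfun (\<lambda>y. f (x * y)))) \<in> Ub"
proof -
  obtain B where B: "\<And>x. \<bar>f x\<bar> \<le> B" using f by (auto simp: Ub_def bounded_iff)
  have "\<bar>\<nu> (Abs_ubfun (\<lambda>y. f (x * y)))\<bar> \<le> norm \<nu> * B" for x
  proof -
    have "Abs_ubfun (\<lambda>_. 0) = (0 :: 'a ubfun)" by (simp add: zero_ubfun_def)
    then show ?thesis
      using abs_blinfun_diff_le[OF left_translate_Ub[OF f] Ub_const[of 0], of x B \<nu>] B
      by simp
  qed
  then have "bounded (range (\<lambda>x. \<nu> (Abs_ubfun (\<lambda>y. f (x * y)))))"
    by (auto simp: bounded_iff)
  moreover have "uniformly_continuous_on UNIV (\<lambda>x. \<nu> (Abs_ubfun (\<lambda>y. f (x * y))))"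
    unfolding uniformly_continuous_real_iff
  proof (intro allI impI)
    fix e :: real assume e: "e > 0"
    define d where "d = e / (norm \<nu> + 1)"
    have n: "norm \<nu> + 1 > 0" by (simp add: add_nonneg_pos)
    then have d: "d > 0" using e by (simp add: d_def)
    have "norm \<nu> * d < (norm \<nu> + 1) * d" using d by (simp add: distrib_right)
    also have "\<dots> = e" using n by (simp add: d_def)
    finally have nd: "norm \<nu> * d < e" .
    have "eventually (\<lambda>(x, y). \<bar>f x - f y\<bar> < d) uniformity"
      using f d by (auto simp: Ub_def uniformly_continuous_real_iff)
    from right_mult_equicontinuous[OF this]
    show "eventually (\<lambda>(x, x'). \<bar>\<nu> (Abs_ubfun (\<lambda>y. f (x * y)))
        - \<nu> (Abs_ubfun (\<lambda>y. f (x' * y)))\<bar> < e) uniformity"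
    proof (rule eventually_mono)
      fix p :: "'a \<times> 'a"
      assume "case p of (x, x') \<Rightarrow> \<forall>y. case (x * y, x' * y) of (x, y) \<Rightarrow> \<bar>f x - f y\<bar> < d"
      then have "\<bar>f (fst p * y) - f (snd p * y)\<bar> \<le> d" for y
        by (auto simp: case_prod_unfold less_imp_le)
      from abs_blinfun_diff_le[OF left_translate_Ub[OF f] left_translate_Ub[OF f] this, of \<nu>]
      show "case p of (x, x') \<Rightarrow> \<bar>\<nu> (Abs_ubfun (\<lambda>y. f (x * y)))
          - \<nu> (Abs_ubfun (\<lambda>y. f (x' * y)))\<bar> < e"
        using nd by (simp add: case_prod_unfold)
    qed
  qed
  ultimately show ?thesis by (simp add: Ub_def)
qed

definition convolution ::
    "('a::semiuniform_semigroup ubfun \<Rightarrow>\<^sub>L real) \<Rightarrow> ('a ubfun \<Rightarrow>\<^sub>L real) \<Rightarrow> ('a ubfun \<Rightarrow>\<^sub>L real)"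
    (infixl \<open>\<star>\<close> 70)
  where "\<mu> \<star> \<nu> =
    Blinfun (\<lambda>f. \<mu> (Abs_ubfun (\<lambda>x. \<nu> (Abs_ubfun (\<lambda>y. apply_ubfun f (x * y))))))"

lemma convolution_apply:
  fixes \<mu> \<nu> :: "'a::semiuniform_semigroup ubfun \<Rightarrow>\<^sub>L real"
  shows "blinfun_apply (\<mu> \<star> \<nu>) f =
    \<mu> (Abs_ubfun (\<lambda>x. \<nu> (Abs_ubfun (\<lambda>y. apply_ubfun f (x * y)))))"
proof -
  define L where "L f x = Abs_ubfun (\<lambda>y. apply_ubfun f (x * y))" for f :: "'a ubfun" and x
  define C where "C f = Abs_ubfun (\<lambda>x. \<nu> (L f x))" for f
  have L: "apply_ubfun (L f x) y = apply_ubfun f (x * y)" for f x y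
    unfolding L_def by (simp add: Abs_ubfun_inverse left_translate_Ub apply_ubfun)
  have C: "apply_ubfun (C f) x = \<nu> (L f x)" for f x
    unfolding C_def L_def by (simp add: Abs_ubfun_inverse convolve_Ub apply_ubfun)
  have eqI: "f = g" if "\<And>x. apply_ubfun f x = apply_ubfun g x" for f g :: "'a ubfun"
    using that by (simp add: apply_ubfun_inject[symmetric] fun_eq_iff)
  have L_add: "L (f + g) x = L f x + L g x" for f g x
    by (rule eqI) (simp add: L plus_ubfun.rep_eq)
  have L_scale: "L (r *\<^sub>R f) x = r *\<^sub>R L f x" for r f x
    by (rule eqI) (simp add: L scaleR_ubfun.rep_eq)
  have C_add: "C (f + g) = C f + C g" for f g
    by (rule eqI) (simp add: C L_add plus_ubfun.rep_eq blinfun.add_right)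
  have C_scale: "C (r *\<^sub>R f) = r *\<^sub>R C f" for r f
    by (rule eqI) (simp add: C L_scale scaleR_ubfun.rep_eq blinfun.scaleR_right)
  have L_norm: "norm (L f x) \<le> norm f" for f x
    by (rule norm_ubfun_le) (simp add: L abs_apply_ubfun_le)
  have C_norm: "norm (C f) \<le> norm \<nu> * norm f" for f
  proof (rule norm_ubfun_le)
    fix x
    have "\<bar>\<nu> (L f x)\<bar> \<le> norm \<nu> * norm (L f x)" using norm_blinfun[of \<nu> "L f x"] by simp
    also have "\<dots> \<le> norm \<nu> * norm f" by (simp add: L_norm mult_left_mono)
    finally show "\<bar>apply_ubfun (C f) x\<bar> \<le> norm \<nu> * norm f" by (simp add: C)
  qed
  have "bounded_linear C"
    by (rule bounded_linear_intro[of _ "norm \<nu>"])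
      (simp_all add: C_add C_scale C_norm mult.commute[of _ "norm \<nu>"])
  then have "bounded_linear (\<lambda>f. \<mu> (C f))" by (rule blinfun.bounded_linear_right[THEN bounded_linear_compose])
  then show ?thesis
    unfolding convolution_def C_def L_def by (simp add: bounded_linear_Blinfun_apply)
qed

definition right_translate :: "'a::semigroup_mult \<Rightarrow> ('a \<Rightarrow> real) \<Rightarrow> ('a \<Rightarrow> real)"
  where "right_translate x f = (\<lambda>z. f (z * x))"

definition orb :: "('a::semigroup_mult \<Rightarrow> real) \<Rightarrow> ('a \<Rightarrow> real) set"
  where "orb f = {right_translate x f | x. True}"

definition ambitable :: "'a::semiuniform_semigroup itself \<Rightarrow> bool"
  where "ambitable _ \<longleftrightarrow> (\<forall>\<Delta> :: 'a \<Rightarrow> 'a \<Rightarrow> real. uc_pseudometric \<Delta> \<longrightarrow>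
    (\<exists>f \<in> Ub. Lip_plus \<Delta> \<subseteq> closure (orb f)))"

text \<open>\<open>\<Lambda>(S)\<close> for the semigroup with underlying space \<open>T\<close> and multiplication \<open>m\<close>.\<close>

definition Lambda :: "'s topology \<Rightarrow> ('s \<Rightarrow> 's \<Rightarrow> 's) \<Rightarrow> 's set"
  where "Lambda T m = {x \<in> topspace T. continuous_map T T (\<lambda>y. m x y)}"

end

theory Submission
  imports Defs
begin

text \<open>
  Everything rests on the formula \<open>(\<mu> \<star> \<nu>) f = \<mu> (slice \<nu> f)\<close>, where \<open>slice \<nu> f\<close> is the function
  \<open>x \<mapsto> \<nu> (y \<mapsto> f (x * y))\<close>.

  Uniform measures are in \<open>\<Lambda>\<close>. For \<open>\<nu>\<close> in the unit ball and \<open>norm f \<le> 1\<close>, all slices of \<open>f\<close> lie in one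
  set \<open>Lip \<Delta>\<close>, with \<open>\<Delta> x x'\<close> the distance of the left translates of \<open>f\<close> by \<open>x\<close> and \<open>x'\<close>. Hence
  continuity of \<open>\<mu>\<close> on \<open>Lip \<Delta>\<close> gives continuity of \<open>\<nu> \<mapsto> (\<mu> \<star> \<nu>) f\<close> on bounded sets. The claim, however,
  concerns the weak* topology on the whole dual, where the functional has to be evaluation at some
  element of \<open>U\<^sub>b(X)\<close>. This is Grothendieck's theorem that a functional which is
  weak* continuous on the dual ball of a Banach space comes from the space, and the proof
  follows his: up to \<open>\<epsilon>\<close>, the functional is small on the common kernel of finitely many evaluations, so
  by Hahn-Banach it is \<open>\<epsilon>\<close>-close in norm to a linear combination of them
  (\<open>Mu_convolution_approx\<close>). Only finitely many dimensions have to be added, so an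
  induction replaces Zorn's lemma. Testing on point evaluations identifies the limit of
  the approximants as \<open>y \<mapsto> (\<mu> \<star> point_eval y) f\<close> (\<open>Mu_convolution_eval\<close>).

  Elements of \<open>\<Lambda>\<close> are uniform measures. The set \<open>Xbar\<close> is compact by Banach-Alaoglu, and
  \<open>\<nu> \<mapsto> slice \<nu> f\<close> maps it continuously into the space of functions with pointwise
  convergence; the image is compact and contains the orbit of \<open>f\<close>, hence its closure. A continuous map
  from a compact space onto a Hausdorff space is a quotient map, so continuity of
  \<open>\<nu> \<mapsto> \<mu> (slice \<nu> f)\<close> on \<open>Xbar\<close> makes \<open>\<mu>\<close> continuous on the closure of the orbit
  (\<open>continuous_on_closure_orb\<close>). Ambitability places \<open>Lip_plus \<Delta>\<close> inside such a closure.

  Both arguments serve both equations, since the second one uses continuity of \<open>\<nu> \<mapsto> \<mu> \<star> \<nu>\<close>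
  on \<open>Xbar\<close> only. The equation for \<open>Xhat\<close> needs in addition that \<open>Xbar\<close> is closed
  under convolution.
\<close>

section \<open>Two facts about normed spaces\<close>

text \<open>
  The restriction of \<open>\<phi>\<close> to the common kernel of the \<open>l i\<close> has norm at most \<open>e\<close>. If it extends to the
  whole space with the same bound, the difference of \<open>\<phi>\<close> and the extension vanishes on the common kernel
  and is therefore a combination of the \<open>l i\<close>. The induction finds the coefficients directly:
  each step enlarges the subspace on which the bound holds by at most one dimension, by the usual
  one-step Hahn-Banach argument.
\<close>

lemma Hahn_Banach_finite_codim:
  fixes \<phi> :: "'v::real_normed_vector \<Rightarrow> real" and l :: "'i \<Rightarrow> 'v \<Rightarrow> real"
  assumes "finite I" "linear \<phi>" "\<And>i. i \<in> I \<Longrightarrow> linear (l i)"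
    and "\<And>v. (\<forall>i\<in>I. l i v = 0) \<Longrightarrow> \<bar>\<phi> v\<bar> \<le> e * norm v" and "e \<ge> 0"
  shows "\<exists>c. \<forall>v. \<bar>\<phi> v - (\<Sum>i\<in>I. c i * l i v)\<bar> \<le> e * norm v"
  using assms(1-4)
proof (induction I arbitrary: \<phi>)
  case empty
  then show ?case by simp
next
  case (insert j I)
  note lin = linear_add linear_diff linear_scale
  have l: "linear (l i)" if "i \<in> insert j I" for i using insert.prems(2) that .
  define N where "N = {v. \<forall>i\<in>I. l i v = 0}"
  have "\<exists>d. \<forall>v\<in>N. \<bar>\<phi> v - d * l j v\<bar> \<le> e * norm v"
  proof (cases "\<exists>w\<in>N. l j w \<noteq> 0")
    case False
    then have "\<forall>v\<in>N. \<bar>\<phi> v - 0 * l j v\<bar> \<le> e * norm v"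
      using insert.prems(3) by (auto simp: N_def)
    then show ?thesis by blast
  next
    case True
    then obtain w where w: "w \<in> N" "l j w \<noteq> 0" by blast
    \<comment> \<open>By homogeneity it is enough to bound \<open>\<phi> v - d\<close> on the hyperplane \<open>l j v = 1\<close>: the
      number \<open>d\<close> has to lie in each interval with centre \<open>\<phi> v\<close> and radius \<open>e * norm v\<close>, and these
      intervals intersect pairwise by the triangle inequality.\<close>
    define N1 where "N1 = {v \<in> N. l j v = 1}"
    have scale: "v /\<^sub>R l j v \<in> N1" if "v \<in> N" "l j v \<noteq> 0" for v
      using that l by (auto simp: N1_def N_def lin)
    have le: "\<phi> v - e * norm v \<le> \<phi> v' + e * norm v'" if "v \<in> N1" "v' \<in> N1" for v v'
    proof -
      have "\<bar>\<phi> (v - v')\<bar> \<le> e * norm (v - v')"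
        using that l by (intro insert.prems(3)) (auto simp: N1_def N_def lin)
      also have "\<dots> \<le> e * (norm v + norm v')"
        using assms(5) by (intro mult_left_mono norm_triangle_ineq4)
      finally show ?thesis
        using linear_diff[OF insert.prems(1), of v v'] by (simp add: algebra_simps abs_le_iff)
    qed
    define d where "d = (SUP v\<in>N1. \<phi> v - e * norm v)"
    have ne: "N1 \<noteq> {}" using scale[OF w] by blast
    have bdd: "bdd_above ((\<lambda>v. \<phi> v - e * norm v) ` N1)"
      using le scale[OF w] by (auto simp: bdd_above_def)
    have d1: "\<bar>\<phi> v - d\<bar> \<le> e * norm v" if "v \<in> N1" for v
    proof -
      have "\<phi> v - e * norm v \<le> d" unfolding d_def by (rule cSUP_upper[OF that bdd])
      moreover have "d \<le> \<phi> v + e * norm v"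
        unfolding d_def by (rule cSUP_least[OF ne]) (rule le[OF _ that])
      ultimately show ?thesis by (simp add: abs_le_iff)
    qed
    have "\<bar>\<phi> v - d * l j v\<bar> \<le> e * norm v" if v: "v \<in> N" for v
    proof (cases "l j v = 0")
      case True
      then show ?thesis using v insert.prems(3) by (auto simp: N_def)
    next
      case False
      let ?u = "v /\<^sub>R l j v"
      have "v = l j v *\<^sub>R ?u" using False by simp
      then have eq: "\<phi> v = l j v * \<phi> ?u" "norm v = \<bar>l j v\<bar> * norm ?u"
        using linear_scale[OF insert.prems(1), of "l j v" ?u]
        by (metis real_scaleR_def) (metis \<open>v = l j v *\<^sub>R ?u\<close> norm_scaleR)
      have "\<bar>\<phi> v - d * l j v\<bar> = \<bar>l j v\<bar> * \<bar>\<phi> ?u - d\<bar>"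
        unfolding eq(1) abs_mult[symmetric] by (simp only: right_diff_distrib mult.commute)
      also have "\<dots> \<le> \<bar>l j v\<bar> * (e * norm ?u)"
        using d1[OF scale[OF v False]] by (intro mult_left_mono) auto
      finally show ?thesis unfolding eq(2) by (simp only: mult.left_commute)
    qed
    then show ?thesis by blast
  qed
  then obtain d where d: "\<And>v. v \<in> N \<Longrightarrow> \<bar>\<phi> v - d * l j v\<bar> \<le> e * norm v" by blast
  have "linear (\<lambda>v. \<phi> v - d * l j v)"
    using insert.prems(1) l[of j]
    by (intro linearI) (auto simp: lin algebra_simps)
  from insert.IH[OF this l] d
  obtain c where c: "\<And>v. \<bar>\<phi> v - d * l j v - (\<Sum>i\<in>I. c i * l i v)\<bar> \<le> e * norm v"
    by (auto simp: N_def)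
  have "(\<Sum>i\<in>insert j I. (c(j := d)) i * l i v) = d * l j v + (\<Sum>i\<in>I. c i * l i v)" for v
  proof -
    have "(\<Sum>i\<in>I. (c(j := d)) i * l i v) = (\<Sum>i\<in>I. c i * l i v)"
      using insert.hyps(2) by (intro sum.cong) auto
    then show ?thesis using insert.hyps by simp
  qed
  then show ?case using c by (intro exI[of _ "c(j := d)"]) (simp add: diff_diff_eq)
qed

text \<open>
  As a set of functions, the dual ball consists of the linear members of a product of compact
  intervals. It is closed there because linearity is a family of equations between finitely many
  coordinates, so Tychonoff's theorem applies; the compact set is then carried over
  to the type of bounded operators by \<open>Blinfun\<close>.
\<close>

lemma Banach_Alaoglu:
  "compactin strong_operator_topology {\<nu> :: 'v::real_normed_vector \<Rightarrow>\<^sub>L real. norm \<nu> \<le> 1}"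
proof -
  define P where "P = (\<Pi>\<^sub>E v\<in>(UNIV :: 'v set). cball (0::real) (norm v))"
  have "compact P"
  proof -
    have "compactin (product_topology (\<lambda>_. euclidean) UNIV) P"
      unfolding P_def by (subst compactin_PiE) auto
    then show ?thesis by (simp add: euclidean_product_topology)
  qed
  define K where "K = P \<inter> {g. linear g}"
  have coord: "continuous_on UNIV (\<lambda>g :: 'v \<Rightarrow> real. g v)" for v
    by (rule continuous_on_product_coordinates)
  have "{g :: 'v \<Rightarrow> real. linear g} =
      (\<Inter>v w. {g. g (v + w) = g v + g w}) \<inter> (\<Inter>r v. {g. g (r *\<^sub>R v) = r *\<^sub>R g v})"
    by (auto simp: linear_iff)
  moreover have "closed \<dots>"
    by (intro closed_Int closed_INT ballI closed_Collect_eq continuous_intros coord)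
  ultimately have "compact K"
    using \<open>compact P\<close> unfolding K_def by (simp add: compact_Int_closed)
  have bl: "bounded_linear g" "\<bar>g v\<bar> \<le> norm v" if "g \<in> K" for g v
  proof -
    have *: "linear g" "\<And>v. \<bar>g v\<bar> \<le> norm v" using that by (auto simp: K_def P_def)
    then show "bounded_linear g" "\<bar>g v\<bar> \<le> norm v"
      by (auto intro!: bounded_linear_intro[of g 1] simp: linear_add linear_scale)
  qed
  have "continuous_map (subtopology euclidean K) strong_operator_topology Blinfun"
    unfolding continuous_on_strong_operator_topo_iff_coordinatewise
  proof
    fix v :: 'v
    have "continuous_on K (\<lambda>g. blinfun_apply (Blinfun g) v)"
      by (subst continuous_on_cong[OF refl, of _ _ "\<lambda>g. g v"])
        (auto simp: bounded_linear_Blinfun_apply bl intro: continuous_on_subset[OF coord])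
    then show "continuous_map (subtopology euclidean K) euclidean (\<lambda>g. blinfun_apply (Blinfun g) v)"
      by simp
  qed
  moreover have "compactin (subtopology euclidean K) K"
    using \<open>compact K\<close> by (simp add: compactin_subtopology)
  ultimately have "compactin strong_operator_topology (Blinfun ` K)"
    by (rule image_compactin[rotated])
  moreover have "Blinfun ` K = {\<nu>. norm \<nu> \<le> 1}"
  proof (intro equalityI subsetI)
    fix \<nu> :: "'v \<Rightarrow>\<^sub>L real" assume "\<nu> \<in> Blinfun ` K"
    then show "\<nu> \<in> {\<nu>. norm \<nu> \<le> 1}"
      using bl by (auto intro!: norm_blinfun_bound simp: bounded_linear_Blinfun_apply)
  next
    fix \<nu> :: "'v \<Rightarrow>\<^sub>L real" assume "\<nu> \<in> {\<nu>. norm \<nu> \<le> 1}"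
    then have "\<bar>\<nu> v\<bar> \<le> norm v" for v
      using norm_blinfun[of \<nu> v] mult_right_mono[of "norm \<nu>" 1 "norm v"] by simp
    then have "blinfun_apply \<nu> \<in> K"
      by (auto simp: K_def P_def linear_iff blinfun.add_right blinfun.scaleR_right)
    then show "\<nu> \<in> Blinfun ` K" by (metis blinfun_apply_inverse image_eqI)
  qed
  ultimately show ?thesis by simp
qed


section \<open>Translates and slices of a function\<close>

definition left_translate :: "'a::semiuniform_semigroup \<Rightarrow> 'a ubfun \<Rightarrow> 'a ubfun"
  where "left_translate x f = Abs_ubfun (\<lambda>y. f (x * y))"

definition slice :: "('a::semiuniform_semigroup ubfun \<Rightarrow>\<^sub>L real) \<Rightarrow> 'a ubfun \<Rightarrow> 'a ubfun"
  where "slice \<nu> f = Abs_ubfun (\<lambda>x. \<nu> (left_translate x f))"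

lemma ubfun_eqI: "(\<And>x. apply_ubfun f x = apply_ubfun g x) \<Longrightarrow> f = g"
  by (simp add: apply_ubfun_inject[symmetric] fun_eq_iff)

lemma left_translate_apply [simp]: "apply_ubfun (left_translate x f) y = f (x * y)"
  by (simp add: left_translate_def Abs_ubfun_inverse left_translate_Ub apply_ubfun)

lemma slice_apply [simp]: "apply_ubfun (slice \<nu> f) x = \<nu> (left_translate x f)"
  by (simp add: slice_def left_translate_def Abs_ubfun_inverse convolve_Ub apply_ubfun)

lemma convolution_eq_slice: "(\<mu> \<star> \<nu>) f = \<mu> (slice \<nu> f)"
  by (simp add: convolution_apply slice_def left_translate_def)

lemma slice_linear: "linear (\<lambda>\<nu>. slice \<nu> f)"
  by (rule linearI; rule ubfun_eqI)
    (simp_all add: plus_ubfun.rep_eq scaleR_ubfun.rep_eq blinfun.add_left blinfun.scaleR_left)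

lemma point_eval_convolution: "(point_eval x \<star> \<nu>) f = \<nu> (left_translate x f)"
  by (simp add: convolution_eq_slice point_eval_apply)

lemma point_eval_mult: "point_eval x \<star> point_eval y = point_eval (x * y)"
  by (rule blinfun_eqI) (simp add: point_eval_convolution point_eval_apply)

lemma norm_point_eval_le: "norm (point_eval x) \<le> 1"
  by (rule norm_blinfun_bound) (simp_all add: point_eval_apply abs_apply_ubfun_le)

text \<open>
  Uniform equicontinuity of the right multiplications says that \<open>f (x * y)\<close> and \<open>f (x' * y)\<close> are close
  uniformly in \<open>y\<close> when \<open>x\<close> and \<open>x'\<close> are close, that is, \<open>x \<mapsto> left_translate x f\<close> is uniformly
  continuous for the sup norm. This pseudometric is the one that controls all slices of \<open>f\<close>.
\<close>

lemma uc_pseudometric_left_translate: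
  fixes f :: "'a::semiuniform_semigroup ubfun"
  shows "uc_pseudometric (\<lambda>x x'. norm (left_translate x f - left_translate x' f))"
proof -
  define D where "D x x' = norm (left_translate x f - left_translate x' f)" for x x'
  have tri: "D x z \<le> D x y + D y z" for x y z
    using norm_triangle_ineq[of "left_translate x f - left_translate y f"
        "left_translate y f - left_translate z f"] by (simp add: D_def)
  have sym: "D x y = D y x" for x y by (simp add: D_def norm_minus_commute)
  have small: "eventually (\<lambda>(x, x'). D x x' < e) uniformity" if e: "e > 0" for e
  proof -
    have "eventually (\<lambda>(u, v). \<bar>apply_ubfun f u - f v\<bar> < e / 2) uniformity"
      using apply_ubfun[of f] half_gt_zero[OF e] unfolding Ub_def uniformly_continuous_real_iff
      by blast
    from right_mult_equicontinuous[OF this] show ?thesis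
    proof (rule eventually_mono, clarify)
      fix x x' assume "\<forall>y. \<bar>apply_ubfun f (x * y) - f (x' * y)\<bar> < e / 2"
      then have "D x x' \<le> e / 2"
        unfolding D_def by (intro norm_ubfun_le) (auto simp: minus_ubfun.rep_eq less_imp_le)
      then show "D x x' < e" using e by simp
    qed
  qed
  have "uniformly_continuous_on UNIV (\<lambda>(x, y). D x y)"
    unfolding uniformly_continuous_real_iff
  proof (intro allI impI)
    fix e :: real assume "e > 0"
    then have ev: "eventually (\<lambda>(x, x'). D x x' < e / 2) uniformity" by (intro small) simp
    have "eventually (\<lambda>(p, q). D (fst p) (fst q) < e / 2 \<and> D (snd p) (snd q) < e / 2)
        (uniformity :: (('a \<times> 'a) \<times> ('a \<times> 'a)) filter)"
      unfolding uniformity_prod_def eventually_filtermap eventually_prod_filter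
      using ev by (intro exI[of _ "\<lambda>(x, x'). D x x' < e / 2"]) auto
    then show "eventually (\<lambda>(p, q).
        \<bar>(case p of (x, y) \<Rightarrow> D x y) - (case q of (x, y) \<Rightarrow> D x y)\<bar> < e) uniformity"
    proof (rule eventually_mono, clarify)
      fix x y x' y'
      assume "D (fst (x, y)) (fst (x', y')) < e / 2" "D (snd (x, y)) (snd (x', y')) < e / 2"
      then show "\<bar>D x y - D x' y'\<bar> < e"
        using tri[of x y x'] tri[of x' y y'] tri[of x' y' x] tri[of x y' y]
          sym[of x x'] sym[of y y'] by auto
    qed
  qed
  moreover have "0 \<le> D x y" "D x x = 0" for x y by (simp_all add: D_def)
  ultimately have "uc_pseudometric D" unfolding uc_pseudometric_def using tri sym by blast
  then show ?thesis by (simp only: D_def[abs_def])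
qed


section \<open>The closure of X in its space of functionals\<close>

lemma continuous_map_eval: "continuous_map weak_star euclidean (\<lambda>\<nu>. blinfun_apply \<nu> f)"
  by (rule strong_operator_topology_continuous_evaluation)

lemma point_eval_in_Xbar: "point_eval x \<in> Xbar"
  unfolding Xbar_def
  by (rule closure_of_subset[THEN subsetD]) (auto simp: strong_operator_topology_topspace)

lemma norm_Xbar_le:
  fixes \<nu> :: "'a::uniform_space ubfun \<Rightarrow>\<^sub>L real"
  assumes "\<nu> \<in> Xbar"
  shows "norm \<nu> \<le> 1"
proof (rule norm_blinfun_bound)
  fix f :: "'a ubfun"
  have "closedin weak_star {\<nu> \<in> topspace weak_star. blinfun_apply \<nu> f \<in> cball 0 (norm f)}"
    by (rule closedin_continuous_map_preimage[OF continuous_map_eval]) auto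
  then have "Xbar \<subseteq> {\<nu> \<in> topspace weak_star. blinfun_apply \<nu> f \<in> cball 0 (norm f)}"
    unfolding Xbar_def
    by (intro closure_of_minimal)
      (auto simp: strong_operator_topology_topspace point_eval_apply abs_apply_ubfun_le)
  then show "norm (\<nu> f) \<le> 1 * norm f" using assms by auto
qed simp

text \<open>
  \<open>Xbar\<close> is the Samuel compactification of \<open>X\<close>, here obtained as a closed part of the dual ball.
\<close>

lemma compactin_Xbar: "compactin weak_star Xbar"
  by (rule closed_compactin[OF Banach_Alaoglu])
    (auto simp: norm_Xbar_le Xbar_def)

text \<open>
  Convolution is weak* continuous in its left argument for every \<open>\<nu>\<close>, and in its right argument when the
  left one is a point evaluation. So two closure arguments pass from points to \<open>Xbar\<close>,
  first on the right and then on the left.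
\<close>

lemma Xbar_convolution:
  assumes \<mu>: "\<mu> \<in> Xbar" and \<nu>: "\<nu> \<in> Xbar"
  shows "\<mu> \<star> \<nu> \<in> Xbar"
proof -
  have closed: "weak_star closure_of Xbar = Xbar" by (simp add: Xbar_def)
  have left: "point_eval x \<star> \<nu> \<in> Xbar" for x
  proof -
    have "continuous_map weak_star weak_star (\<lambda>\<nu>. point_eval x \<star> \<nu>)"
      unfolding continuous_on_strong_operator_topo_iff_coordinatewise
      by (simp add: point_eval_convolution continuous_map_eval)
    from continuous_map_image_closure_subset[OF this, of "range point_eval"]
    have "(\<lambda>\<nu>. point_eval x \<star> \<nu>) ` Xbar
        \<subseteq> weak_star closure_of ((\<lambda>\<nu>. point_eval x \<star> \<nu>) ` range point_eval)"
      by (simp only: Xbar_def)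
    also have "\<dots> \<subseteq> weak_star closure_of Xbar"
      by (rule closure_of_mono) (auto simp: point_eval_mult point_eval_in_Xbar)
    finally show ?thesis using \<nu> unfolding closed by blast
  qed
  have "continuous_map weak_star weak_star (\<lambda>\<mu>. \<mu> \<star> \<nu>)"
    unfolding continuous_on_strong_operator_topo_iff_coordinatewise
    by (simp add: convolution_eq_slice continuous_map_eval)
  from continuous_map_image_closure_subset[OF this, of "range point_eval"]
  have "(\<lambda>\<mu>. \<mu> \<star> \<nu>) ` Xbar \<subseteq> weak_star closure_of ((\<lambda>\<mu>. \<mu> \<star> \<nu>) ` range point_eval)"
    by (simp only: Xbar_def)
  also have "\<dots> \<subseteq> weak_star closure_of Xbar"
    by (rule closure_of_mono) (auto simp: left)
  finally show ?thesis using \<mu> unfolding closed by blast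
qed


section \<open>Convolution by a uniform measure is weak* continuous\<close>

lemma Ub_uniform_closure:
  assumes "\<And>e. e > 0 \<Longrightarrow> \<exists>k :: 'a::uniform_space ubfun. \<forall>y. \<bar>g y - k y\<bar> \<le> e"
  shows "g \<in> Ub"
proof -
  obtain k :: "'a ubfun" where k: "\<And>y. \<bar>g y - k y\<bar> \<le> 1" using assms[of 1] by auto
  have "\<bar>g y\<bar> \<le> 1 + norm k" for y using k[of y] abs_apply_ubfun_le[of k y] by linarith
  then have "bounded (range g)" by (auto simp: bounded_iff)
  moreover have "uniformly_continuous_on UNIV g"
    unfolding uniformly_continuous_real_iff
  proof (intro allI impI)
    fix e :: real assume "e > 0"
    then obtain k :: "'a ubfun" where k: "\<And>y. \<bar>g y - k y\<bar> \<le> e / 4" using assms[of "e / 4"] by auto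
    have "eventually (\<lambda>(x, y). \<bar>apply_ubfun k x - k y\<bar> < e / 2) uniformity"
      using apply_ubfun[of k] half_gt_zero[OF \<open>e > 0\<close>]
      unfolding Ub_def uniformly_continuous_real_iff by blast
    then show "eventually (\<lambda>(x, y). \<bar>g x - g y\<bar> < e) uniformity"
    proof (rule eventually_mono, clarify)
      fix x y assume "\<bar>apply_ubfun k x - k y\<bar> < e / 2"
      then show "\<bar>g x - g y\<bar> < e" using k[of x] k[of y] by linarith
    qed
  qed
  ultimately show ?thesis by (simp add: Ub_def)
qed

text \<open>
  A basic neighbourhood of \<open>0\<close> for pointwise convergence restricts only finitely many
  values, so it contains every function vanishing at those points. This turns the topological
  condition on \<open>\<mu>\<close> into the hypothesis of \<open>Hahn_Banach_finite_codim\<close>.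
\<close>

lemma Mu_small_on_finite_codim:
  assumes "\<mu> \<in> Mu" "uc_pseudometric \<Delta>" "e > 0"
  obtains F where "finite F"
    "\<And>h. h \<in> Lip \<Delta> \<Longrightarrow> (\<And>x. x \<in> F \<Longrightarrow> h x = 0) \<Longrightarrow> \<bar>\<mu> (Abs_ubfun h)\<bar> < e"
proof -
  have zero: "(\<lambda>_. 0) \<in> Lip \<Delta>" using assms(2) by (simp add: Lip_def uc_pseudometric_def)
  have "continuous_on (Lip \<Delta>) (\<lambda>h. \<mu> (Abs_ubfun h))" using assms by (simp add: Mu_def)
  then obtain U where U: "open U"
    "U \<inter> Lip \<Delta> = (\<lambda>h. \<mu> (Abs_ubfun h)) -` ball 0 e \<inter> Lip \<Delta>"
    unfolding continuous_on_open_invariant by (meson open_ball)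
  have "\<mu> (Abs_ubfun (\<lambda>_. 0)) = 0" by (simp add: zero_ubfun_def[symmetric] blinfun.zero_right)
  then have U0: "(\<lambda>_. 0) \<in> U" using U(2) zero assms(3) by auto
  have "openin (product_topology (\<lambda>_. euclidean) UNIV) U"
    using U(1) by (simp add: open_fun_def)
  from product_topology_open_contains_basis[OF this U0]
  obtain X where X: "(\<lambda>_. 0) \<in> (\<Pi>\<^sub>E i\<in>UNIV. X i)"
      "finite {i. X i \<noteq> topspace euclidean}"
      "(\<Pi>\<^sub>E i\<in>UNIV. X i) \<subseteq> U"
    by blast
  show thesis
  proof (rule that[OF X(2)])
    fix h assume h: "h \<in> Lip \<Delta>" "\<And>x. x \<in> {i. X i \<noteq> topspace euclidean} \<Longrightarrow> h x = 0"
    have "h x \<in> X x" for x using X(1) h(2)[of x] by (cases "X x = UNIV") (auto simp: PiE_iff)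
    then have "h \<in> U" using X(3) by auto
    then show "\<bar>\<mu> (Abs_ubfun h)\<bar> < e" using U(2) h(1) by auto
  qed
qed

lemma slice_in_Lip:
  assumes "norm f \<le> 1" "norm \<nu> \<le> 1"
  shows "apply_ubfun (slice \<nu> f) \<in> Lip (\<lambda>x x'. norm (left_translate x f - left_translate x' f))"
proof -
  have le: "\<bar>\<nu> k\<bar> \<le> norm k" for k
    using norm_blinfun[of \<nu> k] mult_right_mono[OF assms(2), of "norm k"] by simp
  have "norm (left_translate x f) \<le> 1" for x
    using assms(1) by (intro norm_ubfun_le) (auto intro: order_trans[OF abs_apply_ubfun_le])
  then have "\<bar>\<nu> (left_translate x f)\<bar> \<le> 1" for x using le order_trans by blast
  then have "\<nu> (left_translate x f) \<in> {-1..1}" for x by (simp add: abs_le_iff minus_le_iff)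
  moreover have "\<bar>\<nu> (left_translate x f) - \<nu> (left_translate x' f)\<bar>
      \<le> norm (left_translate x f - left_translate x' f)" for x x'
    using le by (simp only: blinfun.diff_right[symmetric])
  ultimately show ?thesis by (simp add: Lip_def)
qed

text \<open>
  The points in the finite set \<open>F\<close> given by continuity of \<open>\<mu>\<close> become the finitely many functionals
  \<open>\<nu> \<mapsto> \<nu> (left_translate x f)\<close>: where they vanish, the slice of \<open>f\<close> vanishes on \<open>F\<close> and \<open>\<mu>\<close> is small on it.
\<close>

lemma Mu_convolution_approx:
  fixes f :: "'a::semiuniform_semigroup ubfun"
  assumes \<mu>: "\<mu> \<in> Mu" and f: "norm f \<le> 1" and e: "e > 0"
  obtains k where "\<And>\<nu>. \<bar>(\<mu> \<star> \<nu>) f - \<nu> k\<bar> \<le> e * norm \<nu>"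
proof -
  obtain F where F: "finite F" "\<And>h. h \<in> Lip (\<lambda>x x'. norm (left_translate x f - left_translate x' f))
      \<Longrightarrow> (\<And>x. x \<in> F \<Longrightarrow> h x = 0) \<Longrightarrow> \<bar>\<mu> (Abs_ubfun h)\<bar> < e"
    using Mu_small_on_finite_codim[OF \<mu> uc_pseudometric_left_translate e] by metis
  have lin: "linear (\<lambda>\<nu>. (\<mu> \<star> \<nu>) f)"
    unfolding convolution_eq_slice
    by (rule linearI)
      (simp_all add: linear_add[OF slice_linear] linear_scale[OF slice_linear]
        blinfun.add_right blinfun.scaleR_right)
  have "\<bar>(\<mu> \<star> \<nu>) f\<bar> \<le> e * norm \<nu>" if \<nu>: "\<forall>x\<in>F. \<nu> (left_translate x f) = 0"
    for \<nu> :: "'a ubfun \<Rightarrow>\<^sub>L real"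
  proof -
    have "\<bar>\<mu> (Abs_ubfun (apply_ubfun (slice (sgn \<nu>) f)))\<bar> < e"
    proof (intro F(2) slice_in_Lip f)
      show "norm (sgn \<nu>) \<le> 1" by (simp add: norm_sgn)
    qed (use \<nu> in \<open>simp add: sgn_div_norm blinfun.scaleR_left\<close>)
    then have "\<bar>(\<mu> \<star> sgn \<nu>) f\<bar> \<le> e" by (simp add: apply_ubfun_inverse convolution_eq_slice)
    moreover have "(\<mu> \<star> \<nu>) f = norm \<nu> * (\<mu> \<star> sgn \<nu>) f"
    proof -
      have "\<nu> = norm \<nu> *\<^sub>R sgn \<nu>" by (cases "\<nu> = 0") (simp_all add: sgn_div_norm)
      then show ?thesis using linear_scale[OF lin, of "norm \<nu>" "sgn \<nu>"] by simp
    qed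
    ultimately show ?thesis
      using mult_left_mono[of "\<bar>(\<mu> \<star> sgn \<nu>) f\<bar>" e "norm \<nu>"] by (simp add: abs_mult mult.commute)
  qed
  moreover have "linear (\<lambda>\<nu>. blinfun_apply \<nu> (left_translate x f))" for x
    by (rule linearI) (simp_all add: blinfun.add_left blinfun.scaleR_left)
  ultimately obtain c where
    "\<And>\<nu>. \<bar>(\<mu> \<star> \<nu>) f - (\<Sum>x\<in>F. c x * \<nu> (left_translate x f))\<bar> \<le> e * norm \<nu>"
    using Hahn_Banach_finite_codim[OF F(1) lin, of "\<lambda>x \<nu>. \<nu> (left_translate x f)" e] e by auto
  then show thesis
    by (intro that[of "\<Sum>x\<in>F. c x *\<^sub>R left_translate x f"])
      (simp add: blinfun.sum_right blinfun.scaleR_right)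
qed

text \<open>
  A function \<open>g\<close> with this property must have the values \<open>(\<mu> \<star> point_eval y) f\<close>. What has to
  be shown is that they form a function in \<open>U\<^sub>b(X)\<close>; this and the identity for general \<open>\<nu>\<close> both follow
  because \<open>g\<close> is the uniform limit of the approximants of \<open>Mu_convolution_approx\<close>.
\<close>

lemma Mu_convolution_eval:
  assumes \<mu>: "\<mu> \<in> Mu"
  obtains g where "\<And>\<nu>. (\<mu> \<star> \<nu>) f = \<nu> g"
proof -
  define f' where "f' = sgn f"
  have f': "norm f' \<le> 1" by (simp add: f'_def norm_sgn)
  define g where "g y = (\<mu> \<star> point_eval y) f'" for y
  have close: "\<exists>k. (\<forall>y. \<bar>g y - apply_ubfun k y\<bar> \<le> e)
      \<and> (\<forall>\<nu>. \<bar>(\<mu> \<star> \<nu>) f' - \<nu> k\<bar> \<le> e * norm \<nu>)" if e: "e > 0" for e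
  proof -
    obtain k where k: "\<And>\<nu>. \<bar>(\<mu> \<star> \<nu>) f' - \<nu> k\<bar> \<le> e * norm \<nu>"
      using Mu_convolution_approx[OF \<mu> f' e] by blast
    have "\<bar>g y - k y\<bar> \<le> e" for y
      using order_trans[OF k[of "point_eval y"] mult_left_mono[OF norm_point_eval_le[of y], of e]] e
      by (simp add: g_def point_eval_apply)
    with k show ?thesis by blast
  qed
  then have "g \<in> Ub" by (intro Ub_uniform_closure) blast
  then have g: "apply_ubfun (Abs_ubfun g) y = g y" for y by (simp add: Abs_ubfun_inverse)
  have "(\<mu> \<star> \<nu>) f' = \<nu> (Abs_ubfun g)" for \<nu>
  proof -
    have "\<bar>(\<mu> \<star> \<nu>) f' - \<nu> (Abs_ubfun g)\<bar> \<le> d" if "d > 0" for d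
    proof -
      \<comment> \<open>Replacing \<open>\<mu> \<star> \<nu>\<close> by \<open>k\<close> and then \<open>k\<close> by \<open>g\<close> costs \<open>e * norm \<nu>\<close> each; the \<open>1\<close> covers \<open>\<nu> = 0\<close>.\<close>
      define e where "e = d / (2 * norm \<nu> + 1)"
      have n: "2 * norm \<nu> + 1 > 0" by (simp add: add_nonneg_pos)
      then have e: "e > 0" using \<open>d > 0\<close> by (simp add: e_def)
      obtain k where k: "\<And>y. \<bar>g y - apply_ubfun k y\<bar> \<le> e" "\<bar>(\<mu> \<star> \<nu>) f' - \<nu> k\<bar> \<le> e * norm \<nu>"
        using close[OF e] by blast
      have "norm (k - Abs_ubfun g) \<le> e"
        using k(1) by (intro norm_ubfun_le) (simp add: minus_ubfun.rep_eq g abs_minus_commute)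
      then have "\<bar>\<nu> k - \<nu> (Abs_ubfun g)\<bar> \<le> norm \<nu> * e"
        using norm_blinfun[of \<nu> "k - Abs_ubfun g"] mult_left_mono[of _ e "norm \<nu>"]
        by (fastforce simp: blinfun.diff_right)
      with k(2) have "\<bar>(\<mu> \<star> \<nu>) f' - \<nu> (Abs_ubfun g)\<bar> \<le> e * (2 * norm \<nu>)"
        by (simp add: algebra_simps)
      also have "\<dots> \<le> e * (2 * norm \<nu> + 1)" using e by simp
      also have "\<dots> = d" using n by (simp add: e_def)
      finally show ?thesis .
    qed
    then show ?thesis by (metis abs_le_zero_iff dense_ge eq_iff_diff_eq_0)
  qed
  moreover have "f = norm f *\<^sub>R f'" by (cases "f = 0") (simp_all add: f'_def sgn_div_norm)
  ultimately have "(\<mu> \<star> \<nu>) f = \<nu> (norm f *\<^sub>R Abs_ubfun g)" for \<nu>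
    by (metis blinfun.scaleR_right)
  then show thesis by (rule that)
qed

lemma Mu_imp_continuous_convolution:
  assumes "\<mu> \<in> Mu"
  shows "continuous_map weak_star weak_star (\<lambda>\<nu>. \<mu> \<star> \<nu>)"
  unfolding continuous_on_strong_operator_topo_iff_coordinatewise
proof
  fix f
  obtain g where "\<And>\<nu>. (\<mu> \<star> \<nu>) f = \<nu> g" using Mu_convolution_eval[OF assms] by blast
  then show "continuous_map weak_star euclidean (\<lambda>\<nu>. (\<mu> \<star> \<nu>) f)"
    by (simp add: continuous_map_eval)
qed


section \<open>Ambitability detects uniform measures\<close>

text \<open>
  The affine map \<open>f \<mapsto> (f + 1) / 2\<close> sends \<open>Lip \<Delta>\<close> into \<open>Lip_plus \<Delta>\<close>, and \<open>\<mu> f\<close> is an affine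
  function of the value of \<open>\<mu>\<close> at the image.
\<close>

lemma Mu_if_continuous_on_Lip_plus:
  fixes \<mu> :: "'a::uniform_space ubfun \<Rightarrow>\<^sub>L real"
  assumes "\<And>\<Delta>. uc_pseudometric \<Delta> \<Longrightarrow> continuous_on (Lip_plus \<Delta>) (\<lambda>f. \<mu> (Abs_ubfun f))"
  shows "\<mu> \<in> Mu"
  unfolding Mu_def mem_Collect_eq
proof (intro allI impI)
  fix \<Delta> :: "'a \<Rightarrow> 'a \<Rightarrow> real" assume \<Delta>: "uc_pseudometric \<Delta>"
  define T where "T f x = (f x + 1) / 2" for f :: "'a \<Rightarrow> real" and x
  have T: "T f \<in> Lip_plus \<Delta>" if "f \<in> Lip \<Delta>" for f
  proof -
    have f: "\<bar>f x - f x'\<bar> \<le> \<Delta> x x'" "f x \<in> {-1..1}" for x x' using that by (auto simp: Lip_def)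
    have "\<bar>T f x - T f x'\<bar> \<le> \<Delta> x x'" for x x'
    proof -
      have "\<bar>T f x - T f x'\<bar> = \<bar>f x - f x'\<bar> / 2" by (simp add: T_def abs_if field_simps)
      also have "\<dots> \<le> \<bar>f x - f x'\<bar>" by simp
      also have "\<dots> \<le> \<Delta> x x'" by (rule f(1))
      finally show ?thesis .
    qed
    moreover have "0 \<le> T f x" "T f x \<le> 1" for x using f(2)[of x] by (auto simp: T_def)
    ultimately show ?thesis by (auto simp: Lip_plus_def Lip_def intro: order_trans[of _ 0])
  qed
  have "continuous_on UNIV T"
    unfolding T_def by (intro continuous_on_coordinatewise_then_product continuous_intros
        continuous_on_product_coordinates) auto
  then have "continuous_on (Lip \<Delta>) (\<lambda>f. \<mu> (Abs_ubfun (T f)))"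
    by (intro continuous_on_compose2[OF assms[OF \<Delta>]]) (auto intro: continuous_on_subset T)
  then have "continuous_on (Lip \<Delta>)
      (\<lambda>f. 2 * \<mu> (Abs_ubfun (T f)) - \<mu> (Abs_ubfun (\<lambda>_. 1)))"
    by (rule continuous_on_diff[OF continuous_on_mult_left continuous_on_const])
  moreover have "\<mu> (Abs_ubfun f) = 2 * \<mu> (Abs_ubfun (T f)) - \<mu> (Abs_ubfun (\<lambda>_. 1))"
    if "f \<in> Lip \<Delta>" for f
  proof -
    have "f \<in> Ub" "T f \<in> Ub"
      using Lip_subset_Ub[OF \<Delta>] that T[OF that] by (auto simp: Lip_plus_def)
    then have "Abs_ubfun f = 2 *\<^sub>R Abs_ubfun (T f) - Abs_ubfun (\<lambda>_. 1)"
      by (intro ubfun_eqI)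
        (simp add: minus_ubfun.rep_eq scaleR_ubfun.rep_eq Abs_ubfun_inverse Ub_const,
          simp add: T_def add_divide_distrib)
    then show ?thesis by (simp add: blinfun.diff_right blinfun.scaleR_right)
  qed
  ultimately show "continuous_on (Lip \<Delta>) (\<lambda>f. \<mu> (Abs_ubfun f))" by simp
qed

text \<open>
  The slice of \<open>f\<close> at \<open>point_eval y\<close> is the right translate of \<open>f\<close> by \<open>y\<close>. So the compact image of \<open>Xbar\<close>
  under \<open>\<nu> \<mapsto> slice \<nu> f\<close> contains the closure of the orbit, and since this map is a quotient map onto
  its image, continuity of \<open>\<mu>\<close> on the image can be tested after composing with it.
\<close>

lemma continuous_on_closure_orb:
  fixes f :: "'a::semiuniform_semigroup ubfun"
  assumes "continuous_map (subtopology weak_star Xbar) weak_star (\<lambda>\<nu>. \<mu> \<star> \<nu>)"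
  shows "continuous_on (closure (orb f)) (\<lambda>h. \<mu> (Abs_ubfun h))"
proof -
  let ?S = "subtopology weak_star (Xbar :: ('a ubfun \<Rightarrow>\<^sub>L real) set)"
  define H where "H \<nu> = apply_ubfun (slice \<nu> f)" for \<nu>
  have "continuous_map weak_star euclidean (\<lambda>\<nu>. H \<nu> x)" for x
    by (simp add: H_def continuous_map_eval)
  then have "continuous_map weak_star euclidean H"
    by (metis continuous_map_componentwise_UNIV euclidean_product_topology)
  then have "continuous_map ?S euclidean H" by (rule continuous_map_from_subtopology)
  moreover have top: "topspace ?S = Xbar" by (simp add: strong_operator_topology_topspace)
  ultimately have H: "continuous_map ?S (top_of_set (H ` Xbar)) H"
    by (simp add: continuous_map_in_subtopology)
  have compact: "compact_space ?S"
    using compactin_subspace compactin_Xbar by blast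
  have "compactin (top_of_set (H ` Xbar)) (H ` Xbar)"
    using image_compactin[OF _ H] compact by (metis compact_space_def top)
  moreover have Hausdorff: "Hausdorff_space (euclidean :: ('a \<Rightarrow> real) topology)"
    unfolding euclidean_product_topology[symmetric]
    by (simp add: Hausdorff_space_product_topology)
  ultimately have "closed (H ` Xbar)"
    by (metis closed_closedin compactin_imp_closedin compactin_subtopology)
  moreover have "orb f \<subseteq> H ` Xbar"
  proof -
    have "right_translate y f = H (point_eval y)" for y
      by (simp add: fun_eq_iff H_def right_translate_def point_eval_apply)
    then show ?thesis using point_eval_in_Xbar by (auto simp: orb_def)
  qed
  ultimately have sub: "closure (orb f) \<subseteq> H ` Xbar" by (rule closure_minimal[rotated])
  have "closed_map ?S (top_of_set (H ` Xbar)) H"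
    by (rule continuous_imp_closed_map[OF H compact Hausdorff_space_subtopology[OF Hausdorff]])
  then have "quotient_map ?S (top_of_set (H ` Xbar)) H"
    using H by (intro continuous_closed_imp_quotient_map) (simp_all only: top topspace_euclidean_subtopology)
  moreover have "continuous_map ?S euclidean ((\<lambda>h. \<mu> (Abs_ubfun h)) \<circ> H)"
    using assms unfolding continuous_on_strong_operator_topo_iff_coordinatewise
    by (simp add: o_def H_def apply_ubfun_inverse convolution_eq_slice)
  ultimately have "continuous_map (top_of_set (H ` Xbar)) euclidean (\<lambda>h. \<mu> (Abs_ubfun h))"
    by (rule continuous_compose_quotient_map)
  then show ?thesis using continuous_on_subset[OF _ sub] by simp
qed

lemma ambitable_continuous_convolution_imp_Mu:
  fixes \<mu> :: "'a::semiuniform_semigroup ubfun \<Rightarrow>\<^sub>L real"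
  assumes "ambitable TYPE('a)"
    and "continuous_map (subtopology weak_star Xbar) weak_star (\<lambda>\<nu>. \<mu> \<star> \<nu>)"
  shows "\<mu> \<in> Mu"
proof (rule Mu_if_continuous_on_Lip_plus)
  fix \<Delta> :: "'a \<Rightarrow> 'a \<Rightarrow> real" assume "uc_pseudometric \<Delta>"
  then obtain f where f: "f \<in> Ub" "Lip_plus \<Delta> \<subseteq> closure (orb f)"
    using assms(1) by (auto simp: ambitable_def)
  then have "apply_ubfun (Abs_ubfun f) = f" by (simp add: Abs_ubfun_inverse)
  with continuous_on_closure_orb[OF assms(2), of "Abs_ubfun f"] f(2)
  show "continuous_on (Lip_plus \<Delta>) (\<lambda>f. \<mu> (Abs_ubfun f))"
    by (auto intro: continuous_on_subset)
qed

theorem corollary3p4: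
  assumes "ambitable TYPE('a::semiuniform_semigroup)"
  shows "(Mu :: ('a ubfun \<Rightarrow>\<^sub>L real) set) = Lambda weak_star (\<star>)
    \<and> (Xhat :: ('a ubfun \<Rightarrow>\<^sub>L real) set) = Lambda (subtopology weak_star Xbar) (\<star>)"
proof (intro conjI equalityI subsetI)
  fix \<mu> :: "'a ubfun \<Rightarrow>\<^sub>L real"
  note top = strong_operator_topology_topspace
  show "\<mu> \<in> Lambda weak_star (\<star>)" if "\<mu> \<in> Mu"
    using Mu_imp_continuous_convolution[OF that] by (simp add: Lambda_def top)
  show "\<mu> \<in> Mu" if "\<mu> \<in> Lambda weak_star (\<star>)"
    using that ambitable_continuous_convolution_imp_Mu[OF assms]
    by (simp add: Lambda_def continuous_map_from_subtopology)
  show "\<mu> \<in> Lambda (subtopology weak_star Xbar) (\<star>)" if "\<mu> \<in> Xhat"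
    using that Mu_imp_continuous_convolution[of \<mu>] Xbar_convolution[of \<mu>]
    by (auto simp: Lambda_def Xhat_def top continuous_map_in_subtopology
        continuous_map_from_subtopology)
  show "\<mu> \<in> Xhat" if "\<mu> \<in> Lambda (subtopology weak_star Xbar) (\<star>)"
    using that ambitable_continuous_convolution_imp_Mu[OF assms, of \<mu>]
    by (auto simp: Lambda_def Xhat_def top continuous_map_in_subtopology)
qed

end
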